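(* Let $\Phi\in\mathbb{R}^{n\times m}$, $y\in\mathbb{R}^n$, $\lambda_0\ge 0$, and let a nonempty subset $\Omega\subseteq\{1,\dots,m\}$ of coefficient indices be given. Suppose that the coefficient vector $x\in\mathbb{R}^m$ is the minimizer of the function $\|y-\Phi x\|_2^2$ subject to $\mathrm{supp}(x)\subset\Omega$. Let $\varepsilon=y-\Phi x$. For an integer $k\ge 1$ define $$q_1(k)=\sup_{j<k}\frac{c(\Phi^T\varepsilon,1)+\sqrt{c^2(\Phi^T\varepsilon,k+j)+(k-j)\lambda_0\,\sigma_{\min,k+j}^2}}{\sigma_{\min,k+j}^2},$$ $$q_2(k)=\sup_{j\ge k}\frac{c(\Phi^T\varepsilon,1)+\sqrt{c^2(\Phi^T\varepsilon,k+j)+(k-j)\lambda_0\,\sigma_{\min,k+j}^2}}{\sigma_{\min,k+j}^2},$$ $$q(k)=\max\{q_1(k),q_2(k)\},$$ where $j$ ranges over nonnegative integers. (1) If $\min_{i\in\Omega}|x_i|>q_1(|\Omega|)$, then, with respect to $\lambda_0$, there is no type-0 optimal subset whose support is of size less than $|\Omega|$. (2) Furthermore, if $\min_{i\in\Omega}|x_i|>q(|\Omega|)$, then $\Omega\subset\Omega'$, where $\Omega'$ is the type-0 optimal subset with respect to $\lambda_0$.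
   Context: Setting: $n>m$; $\Phi\in\mathbb{R}^{n\times m}$ is the model matrix and $y\in\mathbb{R}^n$ the response. $\|x\|_0$ is the number of nonzero entries of $x$, $\mathrm{supp}(x)$ is the set of indices of nonzero entries of $x$, and $|\Omega|$ is the cardinality of $\Omega$. The notation $A\subset B$ allows equality. Problem (P0): $\min_{x\in\mathbb{R}^m}\|y-\Phi x\|_2^2+\lambda_0\|x\|_0$. A subset of $\{1,\dots,m\}$ that is the support of a minimizer of (P0) is called a type-0 optimal subset with respect to $\lambda_0$. For an integer $k\ge1$, $$\sigma_{\min,k}^2=\inf\frac{\|\Phi\delta\|_2^2}{\|\delta\|_2^2}\quad\text{subject to }\|\delta\|_0\le k,$$ the infimum being over nonzero $\delta\in\mathbb{R}^m$. For a vector $v$ and an integer $k\ge 1$, $$c(v,k)=\sqrt{\sum_{i=1}^{k}v_{(i)}^2},$$ where $|v_{(1)}|\ge|v_{(2)}|\ge\cdots$ are the entries of $v$ ordered by nonincreasing magnitude (entries beyond the length of $v$ are taken to be $0$). The quantities $q_1(k)$ and $q_2(k)$ are assumed to exist (in particular the denominators occurring in them are nonzero and the suprema are finite); values of $j$ for which the expression under the square root is negative are disregarded in the supremum. *)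

theory Defs
  imports "HOL-Analysis.Analysis" "HOL-Library.Multiset"
begin

definition supp :: "real ^ 'm \<Rightarrow> 'm set" where
  "supp x = {i. x $ i \<noteq> 0}"

definition l0_norm :: "real ^ 'm \<Rightarrow> nat" where
  "l0_norm x = card (supp x)"

definition P0_objective :: "real ^ 'm ^ 'n \<Rightarrow> real ^ 'n \<Rightarrow> real \<Rightarrow> real ^ 'm \<Rightarrow> real" where
  "P0_objective \<Phi> y lam x = (norm (y - \<Phi> *v x))\<^sup>2 + lam * real (l0_norm x)"

definition type0_optimal :: "real ^ 'm ^ 'n \<Rightarrow> real ^ 'n \<Rightarrow> real \<Rightarrow> 'm set \<Rightarrow> bool" where
  "type0_optimal \<Phi> y lam S \<longleftrightarrow>
     (\<exists>x. is_arg_min (P0_objective \<Phi> y lam) (\<lambda>_. True) x \<and> S = supp x)"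

(* The squared quantity; only meaningful for k \<ge> 1, otherwise the infimum is over the empty set. *)
definition sigma_min_sq :: "real ^ 'm ^ 'n \<Rightarrow> nat \<Rightarrow> real" where
  "sigma_min_sq \<Phi> k =
     (INF \<delta>\<in>{\<delta>. \<delta> \<noteq> 0 \<and> l0_norm \<delta> \<le> k}. (norm (\<Phi> *v \<delta>))\<^sup>2 / (norm \<delta>)\<^sup>2)"

(* The magnitudes of the entries of v, with repetitions, in nonincreasing order. *)
definition sorted_magnitudes :: "real ^ 'm \<Rightarrow> real list" where
  "sorted_magnitudes v =
     rev (sorted_list_of_multiset (image_mset (\<lambda>i. \<bar>v $ i\<bar>) (mset_set UNIV)))"

(* ordered_magnitude v i is the i-th largest magnitude, counting from i = 1. *)
definition ordered_magnitude :: "real ^ 'm \<Rightarrow> nat \<Rightarrow> real" where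
  "ordered_magnitude v i =
     (if 1 \<le> i \<and> i \<le> CARD('m) then sorted_magnitudes v ! (i - 1) else 0)"

definition top_norm :: "real ^ 'm \<Rightarrow> nat \<Rightarrow> real" where
  "top_norm v k = sqrt (\<Sum>i = 1..k. (ordered_magnitude v i)\<^sup>2)"

definition q_radicand :: "real ^ 'm ^ 'n \<Rightarrow> real ^ 'n \<Rightarrow> real \<Rightarrow> nat \<Rightarrow> nat \<Rightarrow> real" where
  "q_radicand \<Phi> \<epsilon> lam k j =
     (top_norm (transpose \<Phi> *v \<epsilon>) (k + j))\<^sup>2
       + (real k - real j) * lam * sigma_min_sq \<Phi> (k + j)"

definition q_term :: "real ^ 'm ^ 'n \<Rightarrow> real ^ 'n \<Rightarrow> real \<Rightarrow> nat \<Rightarrow> nat \<Rightarrow> real" where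
  "q_term \<Phi> \<epsilon> lam k j =
     (top_norm (transpose \<Phi> *v \<epsilon>) 1 + sqrt (q_radicand \<Phi> \<epsilon> lam k j))
       / sigma_min_sq \<Phi> (k + j)"

(* Indices with a negative expression under the square root are disregarded. *)
definition q1_values :: "real ^ 'm ^ 'n \<Rightarrow> real ^ 'n \<Rightarrow> real \<Rightarrow> nat \<Rightarrow> real set" where
  "q1_values \<Phi> \<epsilon> lam k =
     {q_term \<Phi> \<epsilon> lam k j | j. j < k \<and> q_radicand \<Phi> \<epsilon> lam k j \<ge> 0}"

definition q2_values :: "real ^ 'm ^ 'n \<Rightarrow> real ^ 'n \<Rightarrow> real \<Rightarrow> nat \<Rightarrow> real set" where
  "q2_values \<Phi> \<epsilon> lam k =
     {q_term \<Phi> \<epsilon> lam k j | j. j \<ge> k \<and> q_radicand \<Phi> \<epsilon> lam k j \<ge> 0}"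

definition q1 :: "real ^ 'm ^ 'n \<Rightarrow> real ^ 'n \<Rightarrow> real \<Rightarrow> nat \<Rightarrow> real" where
  "q1 \<Phi> \<epsilon> lam k = Sup (q1_values \<Phi> \<epsilon> lam k)"

definition q2 :: "real ^ 'm ^ 'n \<Rightarrow> real ^ 'n \<Rightarrow> real \<Rightarrow> nat \<Rightarrow> real" where
  "q2 \<Phi> \<epsilon> lam k = Sup (q2_values \<Phi> \<epsilon> lam k)"

definition q :: "real ^ 'm ^ 'n \<Rightarrow> real ^ 'n \<Rightarrow> real \<Rightarrow> nat \<Rightarrow> real" where
  "q \<Phi> \<epsilon> lam k = max (q1 \<Phi> \<epsilon> lam k) (q2 \<Phi> \<epsilon> lam k)"

(* Existence of q1 and q2: nonzero denominators and finite suprema. For k \<ge> 1 and lam \<ge> 0 the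
   value sets are nonempty: the radicand is nonnegative at j = 0 and at j = k. A vanishing
   denominator makes the radicand a square, so such an index j is never a disregarded one. *)
definition q1_exists :: "real ^ 'm ^ 'n \<Rightarrow> real ^ 'n \<Rightarrow> real \<Rightarrow> nat \<Rightarrow> bool" where
  "q1_exists \<Phi> \<epsilon> lam k \<longleftrightarrow>
     (\<forall>j<k. sigma_min_sq \<Phi> (k + j) \<noteq> 0) \<and> bdd_above (q1_values \<Phi> \<epsilon> lam k)"

definition q2_exists :: "real ^ 'm ^ 'n \<Rightarrow> real ^ 'n \<Rightarrow> real \<Rightarrow> nat \<Rightarrow> bool" where
  "q2_exists \<Phi> \<epsilon> lam k \<longleftrightarrow>
     (\<forall>j\<ge>k. sigma_min_sq \<Phi> (k + j) \<noteq> 0) \<and> bdd_above (q2_values \<Phi> \<epsilon> lam k)"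

end

theory Submission
  imports Defs
begin

text \<open>
  Let \<open>x'\<close> be a minimizer of (P0) with support \<open>\<Omega>'\<close>, \<open>\<delta> = x' - x\<close>, \<open>g = \<Phi>\<^sup>T \<epsilon>\<close>,
  \<open>k = |\<Omega>|\<close>, \<open>j = |\<Omega>'|\<close> and \<open>s = \<sigma>\<^sup>2\<close> at \<open>k + j\<close>. Comparing the objective at \<open>x'\<close> and \<open>x\<close> gives
  \<open>s |\<delta>|\<^sup>2 - 2 g \<bullet> \<delta> \<le> (k - j) \<lambda>\<^sub>0\<close>. Completing the square on the at most \<open>k + j\<close> coordinates
  in \<open>\<Omega> \<union> \<Omega>'\<close> bounds \<open>|\<delta> - g / s|\<^sup>2\<close> there by the radicand of \<open>q\<close> divided by \<open>s\<^sup>2\<close>, so no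
  coordinate of \<open>\<delta>\<close> exceeds the \<open>j\<close>-th term of \<open>q\<close>. Where \<open>\<Omega>\<close> sticks out of \<open>\<Omega>'\<close>, however,
  \<open>|\<delta>\<^sub>i| = |x\<^sub>i|\<close>, which was assumed to be larger.
\<close>

text \<open>Greedy exchange: peel off the head of \<open>xs\<close> against one element of
  \<open>M\<close> that is no larger. Nonnegativity covers an \<open>M\<close> with fewer than
  \<open>k\<close> elements.\<close>

lemma sum_mset_le_sum_list_take:
  fixes xs :: "real list"
  assumes "sorted_wrt (\<ge>) xs" and "\<forall>a\<in>set xs. 0 \<le> a" and "M \<subseteq># mset xs" and "size M \<le> k"
  shows "sum_mset M \<le> sum_list (take k xs)"
  using assms
proof (induction xs arbitrary: M k)
  case Nil
  then show ?case by simp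
next
  case (Cons a xs)
  show ?case
  proof (cases "M = {#}")
    case True
    have "0 \<le> sum_list (take k (a # xs))"
      using Cons.prems(2) by (intro sum_list_nonneg) (meson in_set_takeD)
    then show ?thesis using True by simp
  next
    case False
    then obtain k' where k: "k = Suc k'"
      using Cons.prems(4) by (cases k) auto
    \<comment> \<open>If \<open>a\<close> lies in \<open>M\<close>, it must be the one removed, so
      that the rest fits into \<open>xs\<close>; otherwise \<open>M\<close> already fits and any
      element will do.\<close>
    obtain b where b: "b \<in># M" "b \<le> a" "M - {#b#} \<subseteq># mset xs"
    proof (cases "a \<in># M")
      case True
      then show ?thesis using that[of a] Cons.prems(3) by (simp add: subset_eq_diff_conv)
    next
      case notin: False
      then have sub: "M \<subseteq># mset xs"
        using Cons.prems(3) by (metis diff_single_trivial mset.simps(2) subset_eq_diff_conv add_mset_add_single)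
      obtain b where "b \<in># M" using False by blast
      moreover have "b \<le> a"
        using mset_subset_eqD[OF sub \<open>b \<in># M\<close>] Cons.prems(1) by auto
      ultimately show ?thesis using that[of b] sub
        by (meson diff_subset_eq_self subset_mset.order_trans)
    qed
    have "size (M - {#b#}) \<le> k'"
      using b(1) Cons.prems(4) k by (simp add: size_Diff_singleton)
    then have "sum_mset (M - {#b#}) \<le> sum_list (take k' xs)"
      using Cons.prems b(3) by (intro Cons.IH) auto
    moreover have "sum_mset M = b + sum_mset (M - {#b#})"
      using b(1) by (metis insert_DiffM sum_mset.add_mset)
    ultimately show ?thesis using b(2) k by simp
  qed
qed

lemma mset_sorted_magnitudes:
  "mset (sorted_magnitudes v) = image_mset (\<lambda>i. \<bar>v $ i\<bar>) (mset_set UNIV)"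
  by (simp add: sorted_magnitudes_def)

lemma length_sorted_magnitudes: "length (sorted_magnitudes (v :: real ^ 'm)) = CARD('m)"
  by (metis mset_sorted_magnitudes size_image_mset size_mset size_mset_set)

lemma sorted_wrt_sorted_magnitudes: "sorted_wrt (\<ge>) (sorted_magnitudes v)"
  by (simp add: sorted_magnitudes_def sorted_wrt_rev)

lemma top_norm_sq:
  "(top_norm v k)\<^sup>2 = sum_list (take k (map power2 (sorted_magnitudes v)))"
proof -
  have "(\<Sum>i=1..k. (ordered_magnitude v i)\<^sup>2) = (\<Sum>i<k. (ordered_magnitude v (Suc i))\<^sup>2)"
    by (rule sum.reindex_bij_witness[where i = Suc and j = "\<lambda>i. i - 1"]) auto
  \<comment> \<open>The default value 0 beyond the length of \<open>v\<close> matches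
    \<open>take\<close> stopping at the end of the list.\<close>
  also have "\<dots> = (\<Sum>i<k. if i < CARD('a) then (sorted_magnitudes v ! i)\<^sup>2 else 0)"
    by (rule sum.cong) (auto simp: ordered_magnitude_def)
  also have "\<dots> = (\<Sum>i\<in>{0..<min k CARD('a)}. (sorted_magnitudes v ! i)\<^sup>2)"
    by (rule sum.mono_neutral_cong_right) auto
  also have "\<dots> = sum_list (take k (map power2 (sorted_magnitudes v)))"
    by (simp add: sum_list_sum_nth length_sorted_magnitudes min.commute)
  finally show ?thesis
    unfolding top_norm_def by (metis real_sqrt_pow2 sum_nonneg zero_le_power2)
qed

text \<open>Squaring is monotone on magnitudes, so the squared list is still nonincreasing, and the
  squares over \<open>T\<close> form a submultiset of it.\<close>

lemma sum_squares_le_top_norm_sq: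
  fixes v :: "real ^ 'm"
  assumes "card T \<le> k"
  shows "(\<Sum>i\<in>T. (v $ i)\<^sup>2) \<le> (top_norm v k)\<^sup>2"
proof -
  let ?L = "map power2 (sorted_magnitudes v)"
  have nonneg: "0 \<le> a" if "a \<in> set (sorted_magnitudes v)" for a
  proof -
    have "a \<in># mset (sorted_magnitudes v)" using that by simp
    then show ?thesis unfolding mset_sorted_magnitudes by auto
  qed
  have "sorted_wrt (\<ge>) ?L"
    unfolding sorted_wrt_map
    by (rule sorted_wrt_mono_rel[OF _ sorted_wrt_sorted_magnitudes]) (simp add: nonneg power_mono)
  moreover have "mset ?L = image_mset (\<lambda>i. (v $ i)\<^sup>2) (mset_set UNIV)"
    by (simp add: mset_sorted_magnitudes multiset.map_comp comp_def)
  then have "image_mset (\<lambda>i. (v $ i)\<^sup>2) (mset_set T) \<subseteq># mset ?L"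
    by (simp add: image_mset_subseteq_mono subset_imp_msubset_mset_set)
  ultimately have "sum_mset (image_mset (\<lambda>i. (v $ i)\<^sup>2) (mset_set T)) \<le> sum_list (take k ?L)"
    using assms by (intro sum_mset_le_sum_list_take) auto
  then show ?thesis
    by (simp add: top_norm_sq sum_unfold_sum_mset)
qed

lemma abs_le_top_norm_1: "\<bar>v $ i\<bar> \<le> top_norm v 1"
proof (rule power2_le_imp_le)
  show "\<bar>v $ i\<bar>\<^sup>2 \<le> (top_norm v 1)\<^sup>2"
    using sum_squares_le_top_norm_sq[of "{i}" 1 v] by simp
qed (simp add: top_norm_def sum_nonneg)

lemma sigma_min_sq_le:
  assumes "\<delta> \<noteq> 0" and "l0_norm \<delta> \<le> k"
  shows "sigma_min_sq \<Phi> k \<le> (norm (\<Phi> *v \<delta>))\<^sup>2 / (norm \<delta>)\<^sup>2"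
  unfolding sigma_min_sq_def
  by (rule cINF_lower) (use assms in \<open>auto intro!: bdd_belowI[of _ 0]\<close>)

text \<open>Clearing the denominator admits \<open>\<delta> = 0\<close>, so the comparison with a
  minimizer need not treat equality separately.\<close>

lemma sigma_min_sq_mult_le:
  assumes "l0_norm \<delta> \<le> k"
  shows "sigma_min_sq \<Phi> k * (norm \<delta>)\<^sup>2 \<le> (norm (\<Phi> *v \<delta>))\<^sup>2"
proof (cases "\<delta> = 0")
  case False
  then show ?thesis
    using sigma_min_sq_le[OF False assms, of \<Phi>] by (simp add: pos_le_divide_eq)
qed simp

text \<open>A coordinate vector is feasible once \<open>k \<ge> 1\<close>; the infimum is then over
  a nonempty set of nonnegative quotients.\<close>

lemma sigma_min_sq_nonneg:
  assumes "k \<ge> 1"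
  shows "0 \<le> sigma_min_sq (\<Phi> :: real ^ 'm ^ 'n) k"
proof -
  have "supp (axis a 1 :: real ^ 'm) = {a}" for a
    by (auto simp: supp_def axis_def)
  then have "axis undefined 1 \<in> {\<delta> :: real ^ 'm. \<delta> \<noteq> 0 \<and> l0_norm \<delta> \<le> k}"
    using assms by (simp add: l0_norm_def axis_eq_0_iff)
  then show ?thesis
    unfolding sigma_min_sq_def by (intro cINF_greatest) (blast, simp)
qed

text \<open>The first conclusion ensures that the index \<open>card \<Omega>'\<close> is not
  disregarded, so the term in the second one does belong to the supremum.\<close>

lemma P0_minimizer_bound:
  fixes \<Phi> :: "real ^ 'm ^ 'n"
  assumes "lam \<ge> 0"
    and "supp x \<subseteq> \<Omega>"
    and "\<epsilon> = y - \<Phi> *v x"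
    and "type0_optimal \<Phi> y lam \<Omega>'"
    and "sigma_min_sq \<Phi> (card \<Omega> + card \<Omega>') \<noteq> 0"
    and "i \<in> \<Omega> - \<Omega>'"
  shows "q_radicand \<Phi> \<epsilon> lam (card \<Omega>) (card \<Omega>') \<ge> 0"
    and "\<bar>x $ i\<bar> \<le> q_term \<Phi> \<epsilon> lam (card \<Omega>) (card \<Omega>')"
proof -
  define k j where "k = card \<Omega>" and "j = card \<Omega>'"
  define s where "s = sigma_min_sq \<Phi> (k + j)"
  define g where "g = transpose \<Phi> *v \<epsilon>"
  define R where "R = q_radicand \<Phi> \<epsilon> lam k j"
  obtain x' where opt: "P0_objective \<Phi> y lam x' \<le> P0_objective \<Phi> y lam x" and \<Omega>': "\<Omega>' = supp x'"
    using assms(4) by (auto simp: type0_optimal_def is_arg_min_linorder)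
  define \<delta> where "\<delta> = x' - x"
  define T where "T = \<Omega> \<union> \<Omega>'"
  have "finite \<Omega>" by simp
  then have "k \<ge> 1"
    using assms(6) unfolding k_def by (metis DiffD1 Suc_leI One_nat_def card_gt_0_iff empty_iff)
  then have s: "s > 0"
    using sigma_min_sq_nonneg[of "k + j" \<Phi>] assms(5) by (simp add: s_def k_def j_def)
  have cardT: "card T \<le> k + j"
    unfolding T_def k_def j_def by (rule card_Un_le)
  have zero: "\<delta> $ l = 0" if "l \<notin> T" for l
    using that assms(2) by (auto simp: \<delta>_def T_def \<Omega>' supp_def)
  then have "supp \<delta> \<subseteq> T"
    by (auto simp: supp_def)
  then have "l0_norm \<delta> \<le> k + j"
    using cardT unfolding l0_norm_def by (meson card_mono finite order_trans)
  then have sd: "s * (norm \<delta>)\<^sup>2 \<le> (norm (\<Phi> *v \<delta>))\<^sup>2"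
    unfolding s_def by (rule sigma_min_sq_mult_le)
  \<comment> \<open>The support of \<open>x\<close> may be smaller than \<open>\<Omega>\<close>;
    since \<open>lam \<ge> 0\<close>, its penalty can be raised to that of \<open>k\<close>
    entries.\<close>
  have "lam * real (l0_norm x) \<le> lam * real k"
    using assms(1,2) by (auto simp: l0_norm_def k_def intro!: mult_left_mono card_mono)
  moreover have "y - \<Phi> *v x' = \<epsilon> - \<Phi> *v \<delta>"
    by (simp add: assms(3) \<delta>_def matrix_vector_mult_diff_distrib)
  moreover have "(norm (y - \<Phi> *v x'))\<^sup>2 + lam * real j \<le> (norm \<epsilon>)\<^sup>2 + lam * real (l0_norm x)"
    using opt by (simp add: P0_objective_def assms(3) l0_norm_def j_def \<Omega>')
  ultimately have "(norm (\<epsilon> - \<Phi> *v \<delta>))\<^sup>2 + lam * real j \<le> (norm \<epsilon>)\<^sup>2 + lam * real k"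
    by (metis add_left_mono order_trans)
  moreover have "\<epsilon> \<bullet> (\<Phi> *v \<delta>) = g \<bullet> \<delta>"
    by (simp add: g_def dot_lmul_matrix)
  \<comment> \<open>Expanding the square cancels the norm of \<open>\<epsilon>\<close>, and
    \<open>sd\<close> replaces the quadratic term by its lower bound.\<close>
  ultimately have ineq: "s * (norm \<delta>)\<^sup>2 - 2 * (g \<bullet> \<delta>) \<le> (real k - real j) * lam"
    using sd by (simp add: power2_norm_eq_inner inner_diff inner_commute algebra_simps)
  have nd: "(norm \<delta>)\<^sup>2 = (\<Sum>l\<in>T. (\<delta> $ l)\<^sup>2)"
    unfolding power2_norm_eq_inner inner_vec_def
    by (rule sum.mono_neutral_cong_right) (auto simp: zero power2_eq_square)
  have gd: "g \<bullet> \<delta> = (\<Sum>l\<in>T. g $ l * \<delta> $ l)"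
    unfolding inner_vec_def by (rule sum.mono_neutral_cong_right) (auto simp: zero)
  \<comment> \<open>The square is completed after scaling by \<open>s\<close>, which makes the bound
    exactly the radicand \<open>R\<close>.\<close>
  have "(\<Sum>l\<in>T. (s * \<delta> $ l - g $ l)\<^sup>2) = s * (s * (norm \<delta>)\<^sup>2 - 2 * (g \<bullet> \<delta>)) + (\<Sum>l\<in>T. (g $ l)\<^sup>2)"
    unfolding nd gd
    by (simp add: power2_eq_square algebra_simps sum.distrib sum_subtractf sum_distrib_left)
  also have "\<dots> \<le> s * ((real k - real j) * lam) + (top_norm g (k + j))\<^sup>2"
    using ineq s cardT by (intro add_mono mult_left_mono sum_squares_le_top_norm_sq) auto
  also have "\<dots> = R"
    by (simp add: R_def q_radicand_def g_def s_def)
  finally have sumR: "(\<Sum>l\<in>T. (s * \<delta> $ l - g $ l)\<^sup>2) \<le> R" .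
  then have "0 \<le> R"
    by (meson order_trans sum_nonneg zero_le_power2)
  then show "q_radicand \<Phi> \<epsilon> lam (card \<Omega>) (card \<Omega>') \<ge> 0"
    by (simp add: R_def k_def j_def)
  have "(s * \<delta> $ i - g $ i)\<^sup>2 \<le> (\<Sum>l\<in>T. (s * \<delta> $ l - g $ l)\<^sup>2)"
    using assms(6) by (intro member_le_sum) (auto simp: T_def)
  with sumR have "\<bar>s * \<delta> $ i - g $ i\<bar> \<le> sqrt R"
    by (intro real_le_rsqrt) simp
  moreover have "\<bar>g $ i\<bar> \<le> top_norm g 1"
    by (rule abs_le_top_norm_1)
  moreover have "\<delta> $ i = - x $ i"
    using assms(6) by (simp add: \<delta>_def \<Omega>' supp_def)
  \<comment> \<open>Triangle inequality for
    \<open>s * \<delta> $ i = (s * \<delta> $ i - g $ i) + g $ i\<close>.\<close>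
  ultimately have "\<bar>s * x $ i\<bar> \<le> top_norm g 1 + sqrt R"
    by simp
  then have "\<bar>x $ i\<bar> \<le> (top_norm g 1 + sqrt R) / s"
    using s by (simp add: pos_le_divide_eq abs_mult mult.commute)
  then show "\<bar>x $ i\<bar> \<le> q_term \<Phi> \<epsilon> lam (card \<Omega>) (card \<Omega>')"
    by (simp add: q_term_def g_def R_def s_def k_def j_def)
qed

theorem theorem3p1:
  fixes \<Phi> :: "real ^ 'm ^ 'n" and y \<epsilon> :: "real ^ 'n" and x :: "real ^ 'm"
    and lam :: real and \<Omega> :: "'m set"
  assumes "CARD('n) > CARD('m)"
    and "lam \<ge> 0"
    and "\<Omega> \<noteq> {}"
    and "is_arg_min (\<lambda>z. (norm (y - \<Phi> *v z))\<^sup>2) (\<lambda>z. supp z \<subseteq> \<Omega>) x"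
    and "\<epsilon> = y - \<Phi> *v x"
    and "q1_exists \<Phi> \<epsilon> lam (card \<Omega>)"
    and "q2_exists \<Phi> \<epsilon> lam (card \<Omega>)"
  shows "(Min ((\<lambda>i. \<bar>x $ i\<bar>) ` \<Omega>) > q1 \<Phi> \<epsilon> lam (card \<Omega>) \<longrightarrow>
           \<not> (\<exists>\<Omega>'. type0_optimal \<Phi> y lam \<Omega>' \<and> card \<Omega>' < card \<Omega>)) \<and>
         (Min ((\<lambda>i. \<bar>x $ i\<bar>) ` \<Omega>) > q \<Phi> \<epsilon> lam (card \<Omega>) \<longrightarrow>
           (\<forall>\<Omega>'. type0_optimal \<Phi> y lam \<Omega>' \<longrightarrow> \<Omega> \<subseteq> \<Omega>'))"
proof -
  let ?k = "card \<Omega>"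
  have supp: "supp x \<subseteq> \<Omega>"
    using assms(4) by (simp add: is_arg_min_def)
  have Min_le: "Min ((\<lambda>i. \<bar>x $ i\<bar>) ` \<Omega>) \<le> \<bar>x $ i\<bar>" if "i \<in> \<Omega>" for i
    using that by simp
  have small: "Min ((\<lambda>i. \<bar>x $ i\<bar>) ` \<Omega>) \<le> q1 \<Phi> \<epsilon> lam ?k"
    if opt: "type0_optimal \<Phi> y lam \<Omega>'" and less: "card \<Omega>' < ?k" for \<Omega>'
  proof -
    \<comment> \<open>A smaller set always misses some index of \<open>\<Omega>\<close>, which is
      why part (1) involves only the terms with \<open>j < k\<close>.\<close>
    have "\<not> \<Omega> \<subseteq> \<Omega>'"
      using less by (meson card_mono finite leD)
    then obtain i where i: "i \<in> \<Omega> - \<Omega>'" by blast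
    have "sigma_min_sq \<Phi> (?k + card \<Omega>') \<noteq> 0"
      using assms(6) less by (simp add: q1_exists_def)
    note bound = P0_minimizer_bound[OF assms(2) supp assms(5) opt this i]
    have "q_term \<Phi> \<epsilon> lam ?k (card \<Omega>') \<le> q1 \<Phi> \<epsilon> lam ?k"
      unfolding q1_def using assms(6) bound(1) less
      by (intro cSup_upper) (auto simp: q1_values_def q1_exists_def)
    then show ?thesis
      using bound(2) Min_le[of i] i by (meson DiffD1 order_trans)
  qed
  have large: "Min ((\<lambda>i. \<bar>x $ i\<bar>) ` \<Omega>) \<le> q2 \<Phi> \<epsilon> lam ?k"
    if opt: "type0_optimal \<Phi> y lam \<Omega>'" and ge: "card \<Omega>' \<ge> ?k" and "\<not> \<Omega> \<subseteq> \<Omega>'" for \<Omega>'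
  proof -
    obtain i where i: "i \<in> \<Omega> - \<Omega>'"
      using \<open>\<not> \<Omega> \<subseteq> \<Omega>'\<close> by blast
    have "sigma_min_sq \<Phi> (?k + card \<Omega>') \<noteq> 0"
      using assms(7) ge by (simp add: q2_exists_def)
    note bound = P0_minimizer_bound[OF assms(2) supp assms(5) opt this i]
    have "q_term \<Phi> \<epsilon> lam ?k (card \<Omega>') \<le> q2 \<Phi> \<epsilon> lam ?k"
      unfolding q2_def using assms(7) bound(1) ge
      by (intro cSup_upper) (auto simp: q2_values_def q2_exists_def)
    then show ?thesis
      using bound(2) Min_le[of i] i by (meson DiffD1 order_trans)
  qed
  \<comment> \<open>Both parts follow by contraposition. In part (2) the minimum exceeds
    \<open>q1\<close> and \<open>q2\<close>: \<open>small\<close> excludes smaller optimal subsets,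
    and \<open>large\<close> forces the others to contain \<open>\<Omega>\<close>.\<close>
  show ?thesis
    using small large by (fastforce simp: q_def not_less)
qed

end
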